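(* Let $K$ be a compact metrizable space and let $X$ be a subspace of $C(K)$ which is asymptotic $\ell_1$ with respect to its normalized Schauder basis $(e_n)$. Set $f_n = |e_n|$ for all $n \in \mathbb{N}$. Then for every $0 < \epsilon < 1$, every $\alpha < \omega_1$ and every infinite subset $N$ of $\mathbb{N}$ there exists an $(\alpha, \epsilon)$ block of $(f_n)$ supported by $N$ (i.e. whose support is contained in $N$).
   Context: All Banach spaces are real; "subspace" means infinite-dimensional closed linear subspace; $C(K)$ has the supremum norm; $|e_n|$ is the pointwise absolute value; $\omega_1$ is the first uncountable ordinal. For finite sets of positive integers, $E<F$ means $\max E<\min F$. Block basis: $u_1<\dots<u_m$ is a block basis of $(e_n)$ if there are finite sets $F_1<\dots<F_m$ and non-zero scalars $\lambda_j$ with $u_i=\sum_{j\in F_i}\lambda_j e_j\neq0$; $\mathrm{supp}\,u_i=F_i$. $X$ is asymptotic $\ell_1$ with respect to $(e_n)$ if there is $C>0$ such that $\|\sum_{i=1}^m u_i\|\ge C\sum_{i=1}^m\|u_i\|$ for every block basis $u_1<\dots<u_m$ of $(e_n)$ with $m\le\min\mathrm{supp}\,u_1$. Schreier families: to each countable ordinal $\alpha\ge1$ a sequence of successor ordinals $(\alpha_n+1)_n$ is associated and fixed: if $\alpha$ is a successor, $\alpha_n=\alpha-1$ for all $n$; if $\alpha$ is a limit, $(\alpha_n+1)$ is a strictly increasing sequence tending to $\alpha$. $S_0=\{\{n\}:n\in\mathbb N\}\cup\{\emptyset\}$. If $\xi=\zeta+1$, $S_\xi=\{\bigcup_{i=1}^nF_i: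 n\in\mathbb N,\ F_i\in S_\zeta\ \forall i\le n,\ n\le\min F_1,\ F_1<\dots<F_n\}$ (with $\emptyset\in S_\xi$). If $\xi$ is a limit, $S_\xi=\bigcup_n\{F\in S_{\xi_n+1}:n\le\min F\}\cup\{\emptyset\}$. $(\alpha,\epsilon)$ block: for $0<\epsilon<1$ and $\alpha<\omega_1$, a norm-one vector $u=\sum_{i\in I}\lambda_if_i$ with $I\subset\mathbb N$ finite and all $\lambda_i>0$ (support $I$) is an $(\alpha,\epsilon)$ block of $(f_n)$ if: (1) there is $t\in K$ such that for every $J\subset I$ with $\|\sum_{i\in J}\lambda_if_i\|\ge\epsilon$ one has $\|\sum_{i\in J}\lambda_if_i\|\le(1+\epsilon)\sum_{i\in J}\lambda_if_i(t)$; (2) $\|\sum_{i\in J}\lambda_if_i\|<\epsilon^2$ for all $J\subset I$ with $J\in S_\alpha$. *)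

theory Defs
  imports "HOL-Analysis.Analysis" "HOL-Library.Countable_Set_Type"
begin

unbundle cardinal_syntax

text \<open>
  The type \<open>countable_ordinal\<close> is \<open>\<omega>\<^sub>1\<close>: the successor cardinal of \<open>\<aleph>\<^sub>0\<close>, a well-order
  whose elements play the role of the ordinals below \<open>\<omega>\<^sub>1\<close>. The lemmas
  \<open>uncountable_countable_ordinal\<close> and \<open>countable_initial_segment\<close> characterise it up to order
  isomorphism.
\<close>

lemma Card_order_omega1: "Card_order (cardSuc natLeq)"
  by (rule cardSuc_Card_order[OF natLeq_Card_order])

lemma Well_order_omega1: "Well_order (cardSuc natLeq)"
  using Card_order_omega1 by (simp add: card_order_on_def)

lemma infinite_Field_omega1: "infinite (Field (cardSuc natLeq))"
  using cardSuc_finite[OF natLeq_Card_order] by (simp add: Field_natLeq)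

typedef countable_ordinal = "Field (cardSuc natLeq)"
  using infinite_Field_omega1 by (metis ex_in_conv finite.emptyI)

instantiation countable_ordinal :: wellorder
begin

definition less_eq_countable_ordinal :: "countable_ordinal \<Rightarrow> countable_ordinal \<Rightarrow> bool" where
  "a \<le> b \<longleftrightarrow> (Rep_countable_ordinal a, Rep_countable_ordinal b) \<in> cardSuc natLeq"

definition less_countable_ordinal :: "countable_ordinal \<Rightarrow> countable_ordinal \<Rightarrow> bool" where
  "(a :: countable_ordinal) < b \<longleftrightarrow> a \<le> b \<and> a \<noteq> b"

instance
proof
  have wo: "wo_rel (cardSuc natLeq)"
    using Well_order_omega1 by (simp add: wo_rel_def)
  fix x y z :: countable_ordinal
  show 1: "x \<le> x"
    using wo_rel.REFL[OF wo] Rep_countable_ordinal[of x]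
    by (auto simp: less_eq_countable_ordinal_def refl_on_def)
  show 2: "x \<le> y \<Longrightarrow> y \<le> x \<Longrightarrow> x = y"
    using wo_rel.ANTISYM[OF wo] Rep_countable_ordinal_inject[of x y]
    by (auto simp: less_eq_countable_ordinal_def antisym_def)
  show "x < y \<longleftrightarrow> x \<le> y \<and> \<not> y \<le> x"
    using 1 2 by (auto simp: less_countable_ordinal_def)
  show "x \<le> y \<Longrightarrow> y \<le> z \<Longrightarrow> x \<le> z"
    using wo_rel.TRANS[OF wo]
    by (auto simp: less_eq_countable_ordinal_def trans_def)
  show "x \<le> y \<or> y \<le> x"
    using wo_rel.TOTALS[OF wo] Rep_countable_ordinal[of x] Rep_countable_ordinal[of y]
    by (auto simp: less_eq_countable_ordinal_def)
next
  fix P :: "countable_ordinal \<Rightarrow> bool" and a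
  assume step: "\<And>x. (\<And>y. y < x \<Longrightarrow> P y) \<Longrightarrow> P x"
  have "wf (inv_image (cardSuc natLeq - Id) Rep_countable_ordinal)"
    using Well_order_omega1 by (auto simp: well_order_on_def)
  moreover have "inv_image (cardSuc natLeq - Id) Rep_countable_ordinal = {(x, y). x < y}"
    by (auto simp: inv_image_def less_countable_ordinal_def less_eq_countable_ordinal_def
        Rep_countable_ordinal_inject)
  ultimately have "wf {(x, y :: countable_ordinal). x < y}"
    by simp
  then show "P a"
    by (rule wf_induct_rule) (use step in auto)
qed

end

lemma Rep_image_lessThan:
  "Rep_countable_ordinal ` {..<a} = underS (cardSuc natLeq) (Rep_countable_ordinal a)"
proof -
  have "x \<in> Rep_countable_ordinal ` {..<a}"
    if "x \<noteq> Rep_countable_ordinal a" "(x, Rep_countable_ordinal a) \<in> cardSuc natLeq" for x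
  proof -
    have "x \<in> Field (cardSuc natLeq)"
      using that by (auto simp: Field_def)
    then obtain b where "x = Rep_countable_ordinal b"
      by (metis Abs_countable_ordinal_inverse)
    then show ?thesis
      using that by (auto simp: less_countable_ordinal_def less_eq_countable_ordinal_def)
  qed
  then show ?thesis
    by (auto simp: underS_def less_countable_ordinal_def less_eq_countable_ordinal_def
        Rep_countable_ordinal_inject)
qed

lemma countable_initial_segment: "countable {..<a :: countable_ordinal}"
proof -
  let ?U = "underS (cardSuc natLeq) (Rep_countable_ordinal a)"
  have "|?U| <o cardSuc natLeq"
    using card_of_underS[OF Card_order_omega1] Rep_countable_ordinal by blast
  then have "|?U| \<le>o natLeq"
    using cardSuc_ordLeq_ordLess[OF natLeq_Card_order card_of_Card_order] by blast
  then have "|?U| \<le>o |UNIV :: nat set|"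
    using card_of_nat ordIso_symmetric ordLeq_ordIso_trans by blast
  then have "countable (Rep_countable_ordinal ` {..<a})"
    by (simp add: Rep_image_lessThan countable_card_of_nat)
  then show ?thesis
    by (rule countable_image_inj_on) (simp add: inj_on_def Rep_countable_ordinal_inject)
qed

lemma uncountable_countable_ordinal: "uncountable (UNIV :: countable_ordinal set)"
proof
  assume "countable (UNIV :: countable_ordinal set)"
  then have "countable (range Rep_countable_ordinal)"
    by simp
  moreover have "range Rep_countable_ordinal = Field (cardSuc natLeq)"
    using type_definition.Rep_range[OF type_definition_countable_ordinal] .
  ultimately have "|Field (cardSuc natLeq)| \<le>o natLeq"
    using countable_card_of_nat card_of_nat ordLeq_ordIso_trans by metis
  moreover have "|Field (cardSuc natLeq)| =o cardSuc natLeq"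
    by (rule card_of_Field_ordIso[OF Card_order_omega1])
  ultimately have "cardSuc natLeq \<le>o natLeq"
    using ordIso_symmetric ordIso_ordLeq_trans by blast
  then show False
    using cardSuc_greater[OF natLeq_Card_order] not_ordLess_ordLeq by blast
qed

definition ord_zero :: countable_ordinal where
  "ord_zero = (LEAST a. True)"

definition ord_succ :: "countable_ordinal \<Rightarrow> countable_ordinal" where
  "ord_succ a = (LEAST b. a < b)"

definition ord_limit :: "countable_ordinal \<Rightarrow> bool" where
  "ord_limit a \<longleftrightarrow> a \<noteq> ord_zero \<and> (\<nexists>b. a = ord_succ b)"

lemma less_ord_succ: "a < ord_succ a"
proof -
  have "\<exists>b. a < b"
  proof (rule ccontr)
    assume "\<nexists>b. a < b"
    then have "UNIV = insert a {..<a}"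
      by (auto simp: not_less order.order_iff_strict)
    then show False
      using uncountable_countable_ordinal countable_initial_segment[of a] by (metis countable_insert)
  qed
  then show ?thesis
    unfolding ord_succ_def by (rule LeastI_ex)
qed

text \<open>
  Here and below \<open>\<nat>\<close> is the set of positive integers, so index \<open>0\<close> of a sequence
  \<open>nat \<Rightarrow> _\<close> is never used.
\<close>

definition set_before :: "nat set \<Rightarrow> nat set \<Rightarrow> bool" where
  "set_before E F \<longleftrightarrow> Max E < Min F"

text \<open>
  \<open>A \<alpha> n\<close> is the ordinal \<open>\<alpha>\<^sub>n\<close>, so that the sequence associated to \<open>\<alpha>\<close> is
  \<open>ord_succ (A \<alpha> n)\<close> for \<open>n \<ge> 1\<close>.
\<close>

definition schreier_system :: "(countable_ordinal \<Rightarrow> nat \<Rightarrow> countable_ordinal) \<Rightarrow> bool" where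
  "schreier_system A \<longleftrightarrow>
     (\<forall>\<beta>. \<forall>n\<ge>1. A (ord_succ \<beta>) n = \<beta>) \<and>
     (\<forall>\<alpha>. ord_limit \<alpha> \<longrightarrow>
        strict_mono_on {1..} (\<lambda>n. ord_succ (A \<alpha> n)) \<and>
        (\<forall>n\<ge>1. ord_succ (A \<alpha> n) < \<alpha>) \<and>
        (\<forall>\<beta><\<alpha>. \<exists>n\<ge>1. \<beta> < ord_succ (A \<alpha> n)))"

text \<open>
  The transfinite recursion defining \<open>S\<^sub>\<xi>\<close> is rendered inductively: for a
  \<open>schreier_system\<close> every rule leads from smaller ordinals to a larger one, and exactly one of the
  cases zero, successor, limit applies to each ordinal. In the successor case the pieces
  \<open>F\<^sub>1 < \<dots> < F\<^sub>n\<close> are non-empty, as is needed for \<open>min\<close> and \<open>max\<close> to make sense; the empty set is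
  put into every family separately.
\<close>

inductive_set schreier ::
  "(countable_ordinal \<Rightarrow> nat \<Rightarrow> countable_ordinal) \<Rightarrow> (countable_ordinal \<times> nat set) set"
  for A :: "countable_ordinal \<Rightarrow> nat \<Rightarrow> countable_ordinal"
where
  empty: "(\<xi>, {}) \<in> schreier A"
| zero: "n \<ge> 1 \<Longrightarrow> (ord_zero, {n}) \<in> schreier A"
| succ: "\<lbrakk>n \<ge> 1; \<And>i. i \<in> {1..n} \<Longrightarrow> (\<zeta>, F i) \<in> schreier A; \<And>i. i \<in> {1..n} \<Longrightarrow> F i \<noteq> {};
          n \<le> Min (F 1); \<And>i. i \<in> {1..<n} \<Longrightarrow> set_before (F i) (F (Suc i))\<rbrakk>
         \<Longrightarrow> (ord_succ \<zeta>, \<Union>i\<in>{1..n}. F i) \<in> schreier A"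
| limit: "\<lbrakk>ord_limit \<xi>; n \<ge> 1; (ord_succ (A \<xi> n), F) \<in> schreier A; F \<noteq> {}; n \<le> Min F\<rbrakk>
         \<Longrightarrow> (\<xi>, F) \<in> schreier A"

definition schreier_family ::
  "(countable_ordinal \<Rightarrow> nat \<Rightarrow> countable_ordinal) \<Rightarrow> countable_ordinal \<Rightarrow> nat set set" where
  "schreier_family A \<xi> = {F. (\<xi>, F) \<in> schreier A}"

definition banach_subspace :: "'v::real_normed_vector set \<Rightarrow> bool" where
  "banach_subspace X \<longleftrightarrow> subspace X \<and> closed X \<and> \<not> (\<exists>B. finite B \<and> X \<subseteq> span B)"

definition normalized_schauder_basis :: "(nat \<Rightarrow> 'v::real_normed_vector) \<Rightarrow> 'v set \<Rightarrow> bool" where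
  "normalized_schauder_basis e X \<longleftrightarrow>
     (\<forall>n\<ge>1. e n \<in> X \<and> norm (e n) = 1) \<and>
     (\<forall>x\<in>X. \<exists>!a :: nat \<Rightarrow> real. (\<lambda>n. a n *\<^sub>R e (Suc n)) sums x)"

definition block_basis ::
  "(nat \<Rightarrow> 'v::real_normed_vector) \<Rightarrow> nat \<Rightarrow> (nat \<Rightarrow> 'v) \<Rightarrow> (nat \<Rightarrow> nat set) \<Rightarrow> bool" where
  "block_basis e m u F \<longleftrightarrow>
     (\<forall>i\<in>{1..m}. finite (F i) \<and> F i \<noteq> {} \<and> F i \<subseteq> {1..}) \<and>
     (\<forall>i\<in>{1..<m}. set_before (F i) (F (Suc i))) \<and>
     (\<exists>l :: nat \<Rightarrow> real. \<forall>i\<in>{1..m}.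
        (\<forall>j\<in>F i. l j \<noteq> 0) \<and> u i = (\<Sum>j\<in>F i. l j *\<^sub>R e j) \<and> u i \<noteq> 0)"

definition asymptotic_l1 :: "(nat \<Rightarrow> 'v::real_normed_vector) \<Rightarrow> bool" where
  "asymptotic_l1 e \<longleftrightarrow>
     (\<exists>C>0. \<forall>m\<ge>1. \<forall>u F. block_basis e m u F \<and> m \<le> Min (F 1) \<longrightarrow>
        norm (\<Sum>i=1..m. u i) \<ge> C * (\<Sum>i=1..m. norm (u i)))"

text \<open>
  For \<open>K\<close> compact, \<open>C(K)\<close> with the supremum norm is the type \<open>K \<Rightarrow>\<^sub>C real\<close> of bounded continuous
  functions.
\<close>

definition abs_bcontfun :: "('a::topological_space \<Rightarrow>\<^sub>C real) \<Rightarrow> ('a \<Rightarrow>\<^sub>C real)" where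
  "abs_bcontfun g = Bcontfun (\<lambda>t. \<bar>g t\<bar>)"

lemma apply_abs_bcontfun [simp]: "abs_bcontfun g t = \<bar>g t\<bar>"
proof -
  have "bounded (range (\<lambda>t. \<bar>g t\<bar>))"
    using bounded_apply_bcontfun[of g] by (auto simp: bounded_iff)
  then have "(\<lambda>t. \<bar>g t\<bar>) \<in> bcontfun"
    by (auto simp: bcontfun_def intro: continuous_intros)
  then show ?thesis
    by (simp add: abs_bcontfun_def Bcontfun_inverse)
qed

definition is_block ::
  "(countable_ordinal \<Rightarrow> nat \<Rightarrow> countable_ordinal) \<Rightarrow> countable_ordinal \<Rightarrow> real \<Rightarrow>
   (nat \<Rightarrow> 'a::topological_space \<Rightarrow>\<^sub>C real) \<Rightarrow> ('a \<Rightarrow>\<^sub>C real) \<Rightarrow> nat set \<Rightarrow> bool" where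
  "is_block A \<alpha> \<epsilon> f u I \<longleftrightarrow>
     finite I \<and> I \<subseteq> {1..} \<and> norm u = 1 \<and>
     (\<exists>l :: nat \<Rightarrow> real.
        (\<forall>i\<in>I. l i > 0) \<and> u = (\<Sum>i\<in>I. l i *\<^sub>R f i) \<and>
        (\<exists>t. \<forall>J\<subseteq>I. norm (\<Sum>i\<in>J. l i *\<^sub>R f i) \<ge> \<epsilon> \<longrightarrow>
           norm (\<Sum>i\<in>J. l i *\<^sub>R f i) \<le> (1 + \<epsilon>) * (\<Sum>i\<in>J. l i * f i t)) \<and>
        (\<forall>J\<subseteq>I. J \<in> schreier_family A \<alpha> \<longrightarrow> norm (\<Sum>i\<in>J. l i *\<^sub>R f i) < \<epsilon>\<^sup>2))"

end

theory Submission
  imports Defs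
begin

text \<open>
  Write \<open>p J\<close> for the norm of \<open>\<Sum>j\<in>J. l j *\<^sub>R f j\<close>. If \<open>p I = 1\<close> and \<open>p J + p (I - J) \<le> 1 + \<delta>\<close>
  for all \<open>J \<subseteq> I\<close>, then any point \<open>t\<close> at which the whole vector attains its norm satisfies
  \<open>p J \<le> (\<Sum>j\<in>J. l j * f j t) + \<delta>\<close>, which is condition (1) for small \<open>\<delta>\<close>. So it suffices to find almost
  additive vectors that are small on the Schreier sets, by induction on the ordinal. Sum up \<open>R\<close>
  successive almost additive vectors of lower order: Schreier sets of the next order meet essentially
  one of them, while the sum has norm at least \<open>C * R\<close>. On subsets of its support, its norm is, up to
  a small error, at most an additive measure of total mass \<open>R\<close>. If no large restriction of the sum
  were almost additive, one could split \<open>k\<close> times and gain a factor \<open>(1 + \<delta>) ^ k > 1 / C\<close> over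
  the total mass, which is impossible.
\<close>

section \<open>Schreier families\<close>

lemma less_iff_ord_succ_le: "a < b \<longleftrightarrow> ord_succ a \<le> b"
proof
  show "ord_succ a \<le> b" if "a < b"
    unfolding ord_succ_def using that by (rule Least_le)
  show "a < b" if "ord_succ a \<le> b"
    using less_ord_succ that by (rule less_le_trans)
qed

lemma ord_succ_inject: "ord_succ a = ord_succ b \<longleftrightarrow> a = b"
  by (metis less_iff_ord_succ_le less_ord_succ linorder_neqE not_le)

lemma ord_succ_neq_zero: "ord_succ a \<noteq> ord_zero"
proof -
  have "ord_zero \<le> a"
    unfolding ord_zero_def by (rule Least_le) simp
  then show ?thesis
    using less_ord_succ[of a] by auto
qed

lemma schreier_finite: "(\<xi>, F) \<in> schreier A \<Longrightarrow> finite F"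
  by (induction rule: schreier.induct) auto

text \<open>
  This is the only property of the Schreier families that is needed; it treats zero, successor and
  limit ordinals alike.
\<close>

lemma schreier_tail_cover:
  assumes A: "schreier_system A"
  shows "\<exists>B. finite B \<and> B \<subseteq> {..<\<beta>} \<and>
    (\<forall>F\<in>schreier_family A \<beta>. x \<in> F \<longrightarrow>
      (\<exists>\<G>. finite \<G> \<and> card \<G> \<le> x \<and> \<G> \<subseteq> (\<Union>\<gamma>\<in>B. schreier_family A \<gamma>) \<and>
        F \<inter> {x<..} \<subseteq> \<Union>\<G>))"
proof -
  \<comment> \<open>\<open>B\<close> must depend on \<open>x\<close> and not on \<open>F\<close>. At
    a limit, \<open>x \<in> F\<close> forces \<open>n \<le> Min F \<le> x\<close>, so only the first
    \<open>x\<close> members of the associated sequence can occur. At zero, \<open>B\<close> is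
    empty and a singleton has no tail beyond \<open>x\<close>.\<close>
  define B where "B = {\<gamma>. \<beta> = ord_succ \<gamma>} \<union>
    (if ord_limit \<beta> then (\<lambda>n. ord_succ (A \<beta> n)) ` {1..x} else {})"
  have "{\<gamma>. \<beta> = ord_succ \<gamma>} \<subseteq> {THE \<gamma>. \<beta> = ord_succ \<gamma>}"
    by (auto simp: ord_succ_inject)
  then have fin: "finite B"
    unfolding B_def using finite_subset by auto
  have sub: "B \<subseteq> {..<\<beta>}"
    using A less_ord_succ by (auto simp: B_def schreier_system_def)
  have "\<exists>\<G>. finite \<G> \<and> card \<G> \<le> x \<and> \<G> \<subseteq> (\<Union>\<gamma>\<in>B. schreier_family A \<gamma>) \<and>
        F \<inter> {x<..} \<subseteq> \<Union>\<G>" if F: "(\<beta>, F) \<in> schreier A" and x: "x \<in> F" for F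
    using F
  proof (cases rule: schreier.cases)
    case empty
    then show ?thesis using x by simp
  next
    case (zero n)
    then show ?thesis using x by (intro exI[of _ "{}"]) auto
  next
    case (succ n \<zeta> F')
    \<comment> \<open>The number of pieces is bounded by the minimum of the first piece, while
      \<open>x\<close> may lie in any piece. This comparison of minima gives
      \<open>n \<le> x\<close>.\<close>
    have before: "Min (F' 1) \<le> Min (F' i)" if "i \<in> {1..n}" for i
      using that
    proof (induction i)
      case (Suc i)
      show ?case
      proof (cases "i = 0")
        case False
        with Suc have i: "i \<in> {1..n}" "Suc i \<in> {1..n}" "i \<in> {1..<n}" by auto
        have "Min (F' i) \<le> Max (F' i)"
          using succ(4)[OF i(1)] succ(5)[OF i(1)] schreier_finite by auto
        then show ?thesis
          using Suc.IH[OF i(1)] succ(7)[OF i(3)] by (auto simp: set_before_def)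
      qed simp
    qed simp
    obtain i where i: "i \<in> {1..n}" "x \<in> F' i" using x succ by auto
    have "Min (F' i) \<le> x"
      using i schreier_finite[OF succ(4)[OF i(1)]] by simp
    then have nx: "n \<le> x" using before[OF i(1)] succ(6) by linarith
    have "\<zeta> \<in> B" using succ by (simp add: B_def)
    then have "F' ` {1..n} \<subseteq> (\<Union>\<gamma>\<in>B. schreier_family A \<gamma>)"
      using succ(4) by (auto simp: schreier_family_def)
    moreover have "card (F' ` {1..n}) \<le> x"
      using card_image_le[of "{1..n}" F'] nx by simp
    moreover have "F \<inter> {x<..} \<subseteq> \<Union>(F' ` {1..n})" using succ(2) by auto
    ultimately show ?thesis by (intro exI[of _ "F' ` {1..n}"]) auto
  next
    case (limit n)
    have "Min F \<le> x" using x schreier_finite[OF F] by simp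
    then have n: "n \<in> {1..x}" using limit by auto
    then have "ord_succ (A \<beta> n) \<in> B" using limit by (auto simp: B_def)
    then have "{F} \<subseteq> (\<Union>\<gamma>\<in>B. schreier_family A \<gamma>)"
      using limit by (auto simp: schreier_family_def)
    then show ?thesis using n by (intro exI[of _ "{F}"]) auto
  qed
  then show ?thesis using fin sub by (intro exI[of _ B]) (auto simp: schreier_family_def)
qed

section \<open>Almost additive set functions\<close>

text \<open>Splitting \<open>k\<close> times yields \<open>2 ^ k\<close> disjoint pieces whose
  values of \<open>p\<close> add up to at least \<open>(1 + \<delta>) ^ k * p I\<close>; bounding
  each by \<nu> costs one error \<eta> per piece, and additivity reassembles \<open>\<nu> I\<close>.
  A piece at depth \<open>i\<close> keeps at least \<open>\<delta> ^ i * p I\<close>, so it may be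
  split again.\<close>

lemma almost_additive_subset_or_growth:
  fixes p \<nu> :: "'b set \<Rightarrow> real"
  assumes mono: "\<And>J J'. J' \<subseteq> J \<Longrightarrow> J \<subseteq> I \<Longrightarrow> p J' \<le> p J"
    and bound: "\<And>J. J \<subseteq> I \<Longrightarrow> p J \<le> \<nu> J + \<eta>"
    and add: "\<And>J J'. J' \<subseteq> J \<Longrightarrow> J \<subseteq> I \<Longrightarrow> \<nu> J = \<nu> J' + \<nu> (J - J')"
    and \<delta>: "0 < \<delta>" "\<delta> \<le> 1"
    and "0 \<le> p I"
    and split: "\<And>J. J \<subseteq> I \<Longrightarrow> \<delta> ^ k * p I \<le> p J \<Longrightarrow> \<exists>J'\<subseteq>J. p J' + p (J - J') > (1 + \<delta>) * p J"
  shows "(1 + \<delta>) ^ k * p I \<le> \<nu> I + 2 ^ k * \<eta>"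
  using assms
proof (induction k arbitrary: I)
  case 0
  then show ?case by simp
next
  case (Suc k)
  note mono = Suc.prems(1) and bound = Suc.prems(2) and add = Suc.prems(3)
    and nonneg = Suc.prems(6) and split = Suc.prems(7)
  have "\<delta> ^ Suc k * p I \<le> 1 * p I"
    using \<delta> nonneg by (intro mult_right_mono power_le_one) auto
  then obtain J where J: "J \<subseteq> I" "p J + p (I - J) > (1 + \<delta>) * p I"
    using split[of I] by auto
  have step: "(1 + \<delta>) ^ k * p H \<le> \<nu> H + 2 ^ k * \<eta>" if H: "H \<subseteq> I" "p H \<ge> \<delta> * p I" for H
  proof (rule Suc.IH)
    show "0 \<le> p H" using H(2) \<delta> nonneg by (meson mult_nonneg_nonneg less_imp_le order_trans)
    fix J assume "J \<subseteq> H" "\<delta> ^ k * p H \<le> p J"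
    moreover have "\<delta> ^ Suc k * p I \<le> \<delta> ^ k * p H"
      using H(2) \<delta> by (simp add: mult.assoc mult.left_commute[of \<delta>])
    ultimately show "\<exists>J'\<subseteq>J. p J' + p (J - J') > (1 + \<delta>) * p J"
      using H(1) by (intro split) auto
  qed (use H(1) mono bound add \<delta> in \<open>auto intro!: mono bound add\<close>)
  have le: "p J \<le> p I" "p (I - J) \<le> p I" using mono J(1) by auto
  \<comment> \<open>The two parts together exceed \<open>(1 + \<delta>) * p I\<close> and by
    monotonicity neither exceeds \<open>p I\<close>, so each retains the fraction \<delta>.\<close>
  have big: "p J \<ge> \<delta> * p I" "p (I - J) \<ge> \<delta> * p I"
    using le J(2) by (simp_all add: algebra_simps)
  have "(1 + \<delta>) ^ Suc k * p I = (1 + \<delta>) ^ k * ((1 + \<delta>) * p I)" by simp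
  also have "\<dots> \<le> (1 + \<delta>) ^ k * (p J + p (I - J))"
    using J(2) \<delta> by (intro mult_left_mono) auto
  also have "\<dots> \<le> \<nu> J + 2 ^ k * \<eta> + (\<nu> (I - J) + 2 ^ k * \<eta>)"
    using add_mono[OF step[OF J(1) big(1)] step[OF Diff_subset big(2)]] by (simp add: distrib_left)
  also have "\<dots> = \<nu> I + 2 ^ Suc k * \<eta>" using add[OF J(1)] by simp
  finally show ?case .
qed

section \<open>Positive combinations of the basis\<close>

lemma apply_bcontfun_sum_scaleR:
  fixes g :: "'b \<Rightarrow> 'a::topological_space \<Rightarrow>\<^sub>C real"
  shows "(\<Sum>i\<in>J. l i *\<^sub>R g i) t = (\<Sum>i\<in>J. l i * g i t)"
  by (induction J rule: infinite_finite_induct)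
    (auto simp: plus_bcontfun.rep_eq scaleR_bcontfun.rep_eq zero_bcontfun.rep_eq)

lemma bcontfun_attains_norm:
  fixes g :: "'a::topological_space \<Rightarrow>\<^sub>C real"
  assumes "compact (UNIV :: 'a set)" and "\<And>t. 0 \<le> g t"
  obtains t where "g t = norm g"
proof -
  have "continuous_on UNIV (apply_bcontfun g)"
    by simp
  then obtain t where t: "\<And>s. g s \<le> g t"
    using continuous_attains_sup[OF assms(1) UNIV_not_empty] by blast
  have "norm g \<le> g t"
    using t assms(2) by (intro norm_bound) simp
  moreover have "g t \<le> norm g"
    using norm_bounded[of g t] assms(2)[of t] by simp
  ultimately show ?thesis
    using that by fastforce
qed

locale asymptotic_l1_positive =
  fixes f :: "nat \<Rightarrow> 'a::topological_space \<Rightarrow>\<^sub>C real" and C :: real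
  assumes compact_UNIV: "compact (UNIV :: 'a set)"
    and f_nonneg: "\<And>n t. 0 \<le> f n t"
    and norm_f: "\<And>n. n \<ge> 1 \<Longrightarrow> norm (f n) = 1"
    and C_pos: "0 < C"
    and lower_estimate: "\<And>R I l. \<lbrakk>1 \<le> R; \<And>r. r < R \<Longrightarrow> finite (I r) \<and> I r \<noteq> {} \<and> I r \<subseteq> {1..};
        \<And>r. Suc r < R \<Longrightarrow> Max (I r) < Min (I (Suc r)); R \<le> Min (I 0);
        \<And>j. 0 \<le> l j; \<And>r j. r < R \<Longrightarrow> j \<in> I r \<Longrightarrow> 0 < l j\<rbrakk> \<Longrightarrow>
        C * (\<Sum>r<R. norm (\<Sum>j\<in>I r. l j *\<^sub>R f j)) \<le> norm (\<Sum>j\<in>(\<Union>r<R. I r). l j *\<^sub>R f j)"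
begin

definition p :: "(nat \<Rightarrow> real) \<Rightarrow> nat set \<Rightarrow> real" where
  "p l J = norm (\<Sum>j\<in>J. l j *\<^sub>R f j)"

lemma p_nonneg: "0 \<le> p l J"
  by (simp add: p_def)

lemma p_empty [simp]: "p l {} = 0"
  by (simp add: p_def)

lemma p_cong: "(\<And>j. j \<in> J \<Longrightarrow> l j = l' j) \<Longrightarrow> p l J = p l' J"
  by (simp add: p_def)

lemma p_scale: "0 \<le> c \<Longrightarrow> p (\<lambda>j. c * l j) J = c * p l J"
proof -
  have "(\<Sum>j\<in>J. (c * l j) *\<^sub>R f j) = c *\<^sub>R (\<Sum>j\<in>J. l j *\<^sub>R f j)"
    by (simp add: scaleR_sum_right)
  then show "0 \<le> c \<Longrightarrow> ?thesis"
    by (simp add: p_def)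
qed

lemma p_ge_apply: "(\<Sum>j\<in>J. l j * f j t) \<le> p l J"
  using norm_bounded[of "\<Sum>j\<in>J. l j *\<^sub>R f j" t]
  by (simp add: p_def apply_bcontfun_sum_scaleR)

lemma p_attained:
  assumes "\<And>j. j \<in> J \<Longrightarrow> 0 \<le> l j"
  obtains t where "(\<Sum>j\<in>J. l j * f j t) = p l J"
proof (rule bcontfun_attains_norm[OF compact_UNIV])
  show "0 \<le> (\<Sum>j\<in>J. l j *\<^sub>R f j) t" for t
    using assms f_nonneg by (auto simp: apply_bcontfun_sum_scaleR intro!: sum_nonneg)
qed (simp add: apply_bcontfun_sum_scaleR p_def that)

lemma p_mono:
  assumes "finite J" "J' \<subseteq> J" "\<And>j. j \<in> J \<Longrightarrow> 0 \<le> l j"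
  shows "p l J' \<le> p l J"
proof -
  obtain t where t: "(\<Sum>j\<in>J'. l j * f j t) = p l J'"
    using p_attained[of J' l] assms by blast
  have "p l J' \<le> (\<Sum>j\<in>J. l j * f j t)"
    unfolding t[symmetric] using assms f_nonneg by (intro sum_mono2) auto
  then show ?thesis
    using p_ge_apply order_trans by blast
qed

text \<open>Evaluate at a point where the sum over \<open>J\<close> attains its norm: all terms are
  nonnegative there, so overlaps among the \<open>H r\<close> can only increase the right-hand
  side.\<close>

lemma p_Union_le:
  assumes "finite T" "finite J" "J \<subseteq> (\<Union>r\<in>T. H r)" "\<And>j. j \<in> J \<Longrightarrow> 0 \<le> l j"
  shows "p l J \<le> (\<Sum>r\<in>T. p l (J \<inter> H r))"
proof -
  obtain t where t: "(\<Sum>j\<in>J. l j * f j t) = p l J"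
    using p_attained[of J l] assms by blast
  have "J = (\<Union>r\<in>T. J \<inter> H r)" using assms(3) by auto
  then have "p l J = (\<Sum>j\<in>(\<Union>r\<in>T. J \<inter> H r). l j * f j t)"
    using t by simp
  also have "\<dots> \<le> (\<Sum>r\<in>T. \<Sum>j\<in>J \<inter> H r. l j * f j t)"
    using assms(1)
  proof (induction T rule: finite_induct)
    case (insert r T)
    have "(\<Sum>j\<in>(\<Union>s\<in>insert r T. J \<inter> H s). l j * f j t) \<le>
        (\<Sum>j\<in>J \<inter> H r. l j * f j t) + (\<Sum>j\<in>(\<Union>s\<in>T. J \<inter> H s). l j * f j t)"
      using assms(2,4) f_nonneg insert.hyps(1)
      by (simp add: sum_Un) (auto intro!: sum_nonneg mult_nonneg_nonneg)
    then show ?case using insert by simp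
  qed simp
  also have "\<dots> \<le> (\<Sum>r\<in>T. p l (J \<inter> H r))"
    by (intro sum_mono p_ge_apply)
  finally show ?thesis .
qed

section \<open>Almost additive blocks and their construction by transfinite induction\<close>

text \<open>A set \<open>B\<close> of ordinals replaces a single one because the induction step asks
  for smallness on several lower families at once. Intersecting with \<open>I\<close> lets smallness
  be applied to covering sets that stick out of \<open>I\<close>.\<close>

definition additive_block :: "(countable_ordinal \<Rightarrow> nat \<Rightarrow> countable_ordinal) \<Rightarrow>
    countable_ordinal set \<Rightarrow> real \<Rightarrow> (nat \<Rightarrow> real) \<Rightarrow> nat set \<Rightarrow> bool" where
  "additive_block A B \<delta> l I \<longleftrightarrow> finite I \<and> I \<subseteq> {1..} \<and> (\<forall>i\<in>I. 0 < l i) \<and> p l I = 1 \<and>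
     (\<forall>J\<subseteq>I. p l J + p l (I - J) \<le> 1 + \<delta>) \<and>
     (\<forall>\<beta>\<in>B. \<forall>F\<in>schreier_family A \<beta>. p l (I \<inter> F) < \<delta>)"

text \<open>Take \<open>t\<close> where the whole vector attains its norm 1. Since
  \<open>p l (I - J)\<close> is at least the value of the complementary sum at \<open>t\<close>,
  almost additivity leaves for \<open>p l J\<close> at most the value of its own sum plus
  \<delta>.\<close>

lemma additive_block_measure:
  assumes "additive_block A B \<delta> l I"
  obtains t where "(\<Sum>i\<in>I. l i * f i t) = 1"
    and "\<And>J. J \<subseteq> I \<Longrightarrow> p l J \<le> (\<Sum>i\<in>J. l i * f i t) + \<delta>"
proof -
  have blk: "finite I" "\<forall>i\<in>I. 0 < l i" "p l I = 1" "\<And>J. J \<subseteq> I \<Longrightarrow> p l J + p l (I - J) \<le> 1 + \<delta>"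
    using assms by (auto simp: additive_block_def)
  obtain t where t: "(\<Sum>i\<in>I. l i * f i t) = 1"
    using p_attained[of I l] blk by (metis less_imp_le)
  have "p l J \<le> (\<Sum>i\<in>J. l i * f i t) + \<delta>" if "J \<subseteq> I" for J
    using blk(4)[OF that] p_ge_apply[where l = l and J = "I - J" and t = t] t
      sum.subset_diff[OF that blk(1), of "\<lambda>i. l i * f i t"] by linarith
  then show ?thesis using that t by blast
qed

lemma additive_block_singleton:
  assumes "i \<ge> 1" "0 \<le> \<delta>"
  shows "additive_block A {} \<delta> (\<lambda>_. 1) {i}"
proof -
  have "p (\<lambda>_. 1) {i} = 1"
    using norm_f[OF assms(1)] by (simp add: p_def)
  then have "p (\<lambda>_. 1) J + p (\<lambda>_. 1) ({i} - J) \<le> 1 + \<delta>" if "J \<subseteq> {i}" for J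
    using subset_singletonD[OF that] assms(2) by auto
  then show ?thesis
    using assms(1) \<open>p (\<lambda>_. 1) {i} = 1\<close> unfolding additive_block_def by simp
qed

lemma additive_block_mono:
  assumes "additive_block A B \<delta> l I" "\<delta> \<le> \<delta>'"
  shows "additive_block A B \<delta>' l I"
  unfolding additive_block_def
proof (intro conjI ballI allI impI)
  show "p l J + p l (I - J) \<le> 1 + \<delta>'" if "J \<subseteq> I" for J
    using assms that unfolding additive_block_def by (metis add_left_mono order_trans)
  show "p l (I \<inter> F) < \<delta>'" if "\<beta> \<in> B" "F \<in> schreier_family A \<beta>" for \<beta> F
    using assms that unfolding additive_block_def by (metis less_le_trans)
qed (use assms(1) in \<open>simp_all add: additive_block_def\<close>)

lemma additive_block_normalize:
  assumes "finite J" "J \<subseteq> {1..}" "\<And>i. i \<in> J \<Longrightarrow> 0 < l i" and pos: "0 < p l J"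
    and add: "\<And>J'. J' \<subseteq> J \<Longrightarrow> p l J' + p l (J - J') \<le> (1 + \<delta>) * p l J"
    and small: "\<And>\<beta> F. \<beta> \<in> B \<Longrightarrow> F \<in> schreier_family A \<beta> \<Longrightarrow> p l (J \<inter> F) < \<delta> * p l J"
  shows "additive_block A B \<delta> (\<lambda>j. (1 / p l J) * l j) J"
proof -
  have "p (\<lambda>j. (1 / p l J) * l j) J' = p l J' / p l J" for J'
    using pos p_scale[of "1 / p l J"] by simp
  then show ?thesis
    using assms unfolding additive_block_def
    by (auto simp: divide_less_eq pos_divide_le_eq simp flip: add_divide_distrib)
qed

text \<open>\<open>lower\<close> is the induction hypothesis, for finite sets of ordinals each below
  some element of \<open>B\<close>. The choices are ordered: \<open>k\<close> from \<delta> and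
  \<open>C\<close>, then \<open>R\<close> from \<open>k\<close>, then the accuracy of each block
  from the last index used before it.\<close>

lemma additive_block_step:
  assumes A: "schreier_system A" and B: "finite B" and \<delta>: "0 < \<delta>" "\<delta> \<le> 1"
    and N: "infinite N"
    and lower: "\<And>B' \<delta>' N'. \<lbrakk>finite B'; \<And>\<gamma>. \<gamma> \<in> B' \<Longrightarrow> \<exists>\<beta>\<in>B. \<gamma> < \<beta>; 0 < \<delta>'; infinite N'\<rbrakk> \<Longrightarrow>
        \<exists>l I. additive_block A B' \<delta>' l I \<and> I \<subseteq> N'"
  shows "\<exists>l I. additive_block A B \<delta> l I \<and> I \<subseteq> N"
proof -
  \<comment> \<open>After \<open>k\<close> splittings the growth
    \<open>(1 + \<delta>) ^ k * C * R\<close> must exceed \<open>2 * R\<close>: the total mass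
    \<open>R\<close> plus an accumulated error \<open>R\<close>.\<close>
  obtain k where "2 / C < (1 + \<delta>) ^ k"
    using real_arch_pow[of "1 + \<delta>"] \<delta> by auto
  then have k: "2 < (1 + \<delta>) ^ k * C"
    using C_pos by (simp add: field_simps)
  \<comment> \<open>The subset extracted later has norm at least
    \<open>\<delta> ^ k * (C * R)\<close>; times \<delta> this must beat 2, the bound for the sum on
    a single Schreier set.\<close>
  obtain R where R': "2 / (\<delta> * \<delta> ^ k * C) < real R"
    using reals_Archimedean2 by blast
  then have R: "2 < \<delta> * (\<delta> ^ k * (C * R))"
    using \<delta> C_pos by (simp add: field_simps)
  have R1: "1 \<le> R" using R by (cases R) auto
  obtain D where D: "\<And>\<beta> x. finite (D \<beta> x)" "\<And>\<beta> x. D \<beta> x \<subseteq> {..<\<beta>}"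
    "\<And>\<beta> x F. F \<in> schreier_family A \<beta> \<Longrightarrow> x \<in> F \<Longrightarrow>
      \<exists>\<G>. finite \<G> \<and> card \<G> \<le> x \<and> \<G> \<subseteq> (\<Union>\<gamma>\<in>D \<beta> x. schreier_family A \<gamma>) \<and> F \<inter> {x<..} \<subseteq> \<Union>\<G>"
    using schreier_tail_cover[OF A] by metis
  \<comment> \<open>The first bound keeps the additivity errors of \<open>R\<close> blocks,
    multiplied by \<open>2 ^ k\<close> pieces, below \<open>R\<close>. The second makes at most
    \<open>m\<close> covering sets contribute at most \<open>1 / R\<close> in one block; the
    \<open>+ 1\<close> avoids division by zero.\<close>
  define \<delta>' where "\<delta>' m = min (1 / 2 ^ k) (1 / (R * (real m + 1)))" for m
  have \<delta>'_pos: "0 < \<delta>' m" for m using R1 by (auto simp: \<delta>'_def)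
  \<comment> \<open>A Schreier set that meets an earlier block does so at some
    \<open>x \<le> m\<close>, so this finite union contains all families needed to cover its
    tail.\<close>
  have "\<exists>l I. additive_block A (\<Union>\<beta>\<in>B. \<Union>x\<le>m. D \<beta> x) (\<delta>' m) l I \<and> I \<subseteq> N \<inter> {m<..}" for m
  proof (rule lower)
    have "N \<inter> {m<..} = N - {..m}" by auto
    then show "infinite (N \<inter> {m<..})" using N by simp
    show "\<exists>\<beta>\<in>B. \<gamma> < \<beta>" if "\<gamma> \<in> (\<Union>\<beta>\<in>B. \<Union>x\<le>m. D \<beta> x)" for \<gamma> using that D(2) by fastforce
  qed (use B D(1) \<delta>'_pos in auto)
  then obtain l0 I0 where
    blk0: "\<And>m. additive_block A (\<Union>\<beta>\<in>B. \<Union>x\<le>m. D \<beta> x) (\<delta>' m) (l0 m) (I0 m)" and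
    I0: "\<And>m. I0 m \<subseteq> N \<inter> {m<..}" by metis
  \<comment> \<open>Starting at \<open>R\<close> places every block beyond \<open>R\<close>, as the
    asymptotic estimate for \<open>R\<close> blocks demands.\<close>
  define m where "m = rec_nat R (\<lambda>_ m. Max (I0 m))"
  have m_0: "m 0 = R" and m_Suc: "m (Suc r) = Max (I0 (m r))" for r
    by (simp_all add: m_def)
  define I where "I r = I0 (m r)" for r
  define T where "T = (\<Union>r<R. I r)"
  define l where "l j = (\<Sum>r<R. if j \<in> I r then l0 (m r) j else 0)" for j
  have blk: "additive_block A (\<Union>\<beta>\<in>B. \<Union>x\<le>m r. D \<beta> x) (\<delta>' (m r)) (l0 (m r)) (I r)" for r
    using blk0 by (simp add: I_def)
  have I_fin: "finite (I r)" and I_ne: "I r \<noteq> {}" and I_pos: "I r \<subseteq> {1..}"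
    and l0_pos: "\<And>j. j \<in> I r \<Longrightarrow> 0 < l0 (m r) j" and p_I: "p (l0 (m r)) (I r) = 1" for r
    using blk[of r] by (auto simp: additive_block_def)
  have I_gt: "m r < j" if "j \<in> I r" for r j
    using I0[of "m r"] that by (auto simp: I_def)
  have I_le: "j \<le> m (Suc r)" if "j \<in> I r" for r j
    using I_fin[of r] that by (auto simp: I_def m_Suc)
  have "m r < m (Suc r)" for r
    using I_ne[of r] I_gt[of _ r] I_le[of _ r] by (meson ex_in_conv less_le_trans)
  then have m_mono: "mono m"
    by (simp add: mono_iff_le_Suc less_imp_le)
  have I_before: "i < j" if "i \<in> I r" "j \<in> I s" "r < s" for i j r s
    using I_le[OF that(1)] I_gt[OF that(2)] monoD[OF m_mono, of "Suc r" s] that(3) by linarith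
  have I_disj: "I r \<inter> I s = {}" if "r \<noteq> s" for r s
    using I_before[of _ r _ s] I_before[of _ s _ r] that by (force simp: neq_iff)
  have l_eq: "l j = l0 (m r) j" if "j \<in> I r" "r < R" for j r
  proof -
    have "(if j \<in> I s then l0 (m s) j else 0) = (if s = r then l0 (m r) j else 0)" for s
      using that(1) I_disj[of s r] by auto
    then show ?thesis using that(2) by (simp add: l_def)
  qed
  have l_nonneg: "0 \<le> l j" for j
    unfolding l_def using l0_pos by (intro sum_nonneg) (auto simp: less_imp_le)
  have l_pos: "0 < l j" if "j \<in> T" for j
    using that l_eq l0_pos by (auto simp: T_def)
  have p_eq: "p l J = p (l0 (m r)) J" if "J \<subseteq> I r" "r < R" for J r
    using l_eq that by (intro p_cong) blast
  have T: "finite T" "T \<subseteq> {1..}" "T \<subseteq> N"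
    using I_fin I_pos I0 by (force simp: T_def I_def)+
  have "\<exists>t. (\<Sum>i\<in>I r. l0 (m r) i * f i t) = 1 \<and>
      (\<forall>J\<subseteq>I r. p (l0 (m r)) J \<le> (\<Sum>i\<in>J. l0 (m r) i * f i t) + \<delta>' (m r))" for r
    by (rule additive_block_measure[OF blk[of r]]) blast
  then have "\<exists>t. \<forall>r. (\<Sum>i\<in>I r. l0 (m r) i * f i (t r)) = 1 \<and>
      (\<forall>J\<subseteq>I r. p (l0 (m r)) J \<le> (\<Sum>i\<in>J. l0 (m r) i * f i (t r)) + \<delta>' (m r))"
    by (intro choice allI)
  then obtain t where
    t1: "\<And>r. (\<Sum>i\<in>I r. l0 (m r) i * f i (t r)) = 1" and
    t2: "\<And>r J. J \<subseteq> I r \<Longrightarrow> p (l0 (m r)) J \<le> (\<Sum>i\<in>J. l0 (m r) i * f i (t r)) + \<delta>' (m r)"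
    by blast
  \<comment> \<open>Each block is evaluated at its own point \<open>t r\<close>, so the mass is
    exactly 1 per block although no common point need exist.\<close>
  define \<nu> where "\<nu> J = (\<Sum>r<R. \<Sum>i\<in>J \<inter> I r. l0 (m r) i * f i (t r))" for J
  have p_le_\<nu>: "p l J \<le> \<nu> J + R / 2 ^ k" if "J \<subseteq> T" for J
  proof -
    have "p l J \<le> (\<Sum>r<R. p l (J \<inter> I r))"
      using that finite_subset[OF that T(1)] l_nonneg by (intro p_Union_le) (auto simp: T_def)
    also have "\<dots> \<le> (\<Sum>r<R. (\<Sum>i\<in>J \<inter> I r. l0 (m r) i * f i (t r)) + 1 / 2 ^ k)"
    proof (intro sum_mono)
      fix r assume "r \<in> {..<R}"
      moreover have "\<delta>' (m r) \<le> 1 / 2 ^ k" by (simp add: \<delta>'_def)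
      ultimately show "p l (J \<inter> I r) \<le> (\<Sum>i\<in>J \<inter> I r. l0 (m r) i * f i (t r)) + 1 / 2 ^ k"
        using t2[of "J \<inter> I r" r] p_eq[of "J \<inter> I r" r] by auto
    qed
    finally show ?thesis by (simp add: \<nu>_def sum.distrib)
  qed
  have \<nu>_add: "\<nu> J = \<nu> J' + \<nu> (J - J')" if "J' \<subseteq> J" for J J'
  proof -
    have "(\<Sum>i\<in>J \<inter> I r. h i) = (\<Sum>i\<in>J' \<inter> I r. h i) + (\<Sum>i\<in>(J - J') \<inter> I r. h i)" for r and h :: "nat \<Rightarrow> real"
      using that I_fin[of r] by (subst sum.union_disjoint[symmetric]) (auto intro!: sum.cong)
    then show ?thesis by (simp add: \<nu>_def sum.distrib)
  qed
  have "\<nu> T = (\<Sum>r<R. 1)"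
    unfolding \<nu>_def
  proof (intro sum.cong refl)
    fix r assume "r \<in> {..<R}"
    then have "T \<inter> I r = I r" by (auto simp: T_def)
    then show "(\<Sum>i\<in>T \<inter> I r. l0 (m r) i * f i (t r)) = 1" using t1 by simp
  qed
  then have \<nu>_T: "\<nu> T = R" by simp
  have "C * (\<Sum>r<R. p l (I r)) \<le> p l T"
    unfolding p_def T_def
  proof (rule lower_estimate)
    show "Max (I r) < Min (I (Suc r))" for r
      using I_before[of _ r _ "Suc r"] I_fin I_ne by simp
    show "R \<le> Min (I 0)"
      using I_gt[of _ 0] I_fin I_ne m_0 by (simp add: less_imp_le)
    show "0 < l j" if "r < R" "j \<in> I r" for r j
      using that by (intro l_pos) (auto simp: T_def)
  qed (use R1 I_fin I_ne I_pos l_nonneg in auto)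
  moreover have "(\<Sum>r<R. p l (I r)) = (\<Sum>r<R. 1)"
    using p_eq[OF order_refl] p_I by (intro sum.cong) auto
  ultimately have p_T: "C * R \<le> p l T"
    by simp
  \<comment> \<open>Otherwise every large subset splits with gain, and the growth lemma gives
    \<open>(1 + \<delta>) ^ k * C * R \<le> 2 * R\<close>, against the choice of
    \<open>k\<close>.\<close>
  have "\<exists>J\<subseteq>T. \<delta> ^ k * p l T \<le> p l J \<and> (\<forall>J'\<subseteq>J. p l J' + p l (J - J') \<le> (1 + \<delta>) * p l J)"
  proof (rule ccontr)
    assume neg: "\<not> ?thesis"
    have "(1 + \<delta>) ^ k * p l T \<le> \<nu> T + 2 ^ k * (R / 2 ^ k)"
    proof (rule almost_additive_subset_or_growth)
      show "p l J' \<le> p l J" if "J' \<subseteq> J" "J \<subseteq> T" for J J'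
        using finite_subset[OF that(2) T(1)] that(1) l_nonneg by (intro p_mono) auto
      show "\<exists>J'\<subseteq>J. p l J' + p l (J - J') > (1 + \<delta>) * p l J"
        if "J \<subseteq> T" "\<delta> ^ k * p l T \<le> p l J" for J
        using neg that by (meson not_le)
    qed (rule p_le_\<nu> \<nu>_add \<delta> p_nonneg; assumption)+
    moreover have "(1 + \<delta>) ^ k * (C * R) \<le> (1 + \<delta>) ^ k * p l T"
      using p_T \<delta> by (intro mult_left_mono) auto
    moreover have "2 * real R < ((1 + \<delta>) ^ k * C) * R"
      using k R1 by (intro mult_strict_right_mono) auto
    ultimately show False using \<nu>_T by (simp add: mult.assoc)
  qed
  then obtain J where J: "J \<subseteq> T" "\<delta> ^ k * p l T \<le> p l J"
    "\<And>J'. J' \<subseteq> J \<Longrightarrow> p l J' + p l (J - J') \<le> (1 + \<delta>) * p l J" by blast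
  have "\<delta> ^ k * (C * R) \<le> p l J"
    using p_T J(2) \<delta> by (meson mult_left_mono order_trans zero_le_power less_imp_le)
  then have "\<delta> * (\<delta> ^ k * (C * R)) \<le> \<delta> * p l J"
    using \<delta> by (intro mult_left_mono) auto
  then have p_J: "2 < \<delta> * p l J" using R by linarith
  \<comment> \<open>The first block \<open>I s\<close> met by \<open>F\<close> contributes at most
    1, and the later ones at most \<open>1 / R\<close> each.\<close>
  have small: "p l (T \<inter> F) \<le> 2" if \<beta>: "\<beta> \<in> B" and F: "F \<in> schreier_family A \<beta>" for \<beta> F
  proof (cases "T \<inter> F = {}")
    case False
    define s where "s = (LEAST r. r < R \<and> I r \<inter> F \<noteq> {})"
    have ex: "\<exists>r. r < R \<and> I r \<inter> F \<noteq> {}" using False by (auto simp: T_def)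
    have s: "s < R" "I s \<inter> F \<noteq> {}" unfolding s_def using LeastI_ex[OF ex] by auto
    have before_s: "I r \<inter> F = {}" if "r < s" for r
      using not_less_Least[of r "\<lambda>r. r < R \<and> I r \<inter> F \<noteq> {}"] that s(1) unfolding s_def by auto
    obtain x where x: "x \<in> I s" "x \<in> F" using s(2) by auto
    obtain \<G> where \<G>: "finite \<G>" "card \<G> \<le> x" "\<G> \<subseteq> (\<Union>\<gamma>\<in>D \<beta> x. schreier_family A \<gamma>)"
      "F \<inter> {x<..} \<subseteq> \<Union>\<G>" using D(3)[OF F x(2)] by blast
    \<comment> \<open>Block \<open>r\<close> was chosen after \<open>x\<close> was passed, hence it
      is small on every family in \<open>D \<beta> x\<close>; at most \<open>x \<le> m r\<close>
      sets from these cover its part of \<open>F\<close>.\<close>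
    have after_s: "p l (I r \<inter> F) \<le> 1 / R" if r: "r < R" "s < r" for r
    proof -
      have xm: "x \<le> m r" using I_le[OF x(1)] monoD[OF m_mono, of "Suc s" r] r(2) by linarith
      have "I r \<inter> F \<subseteq> (\<Union>G\<in>\<G>. G)"
        using \<G>(4) I_before[OF x(1) _ r(2)] by auto
      then have "p l (I r \<inter> F) \<le> (\<Sum>G\<in>\<G>. p l (I r \<inter> F \<inter> G))"
        using \<G>(1) I_fin l_nonneg by (intro p_Union_le) auto
      also have "\<dots> \<le> (\<Sum>G\<in>\<G>. \<delta>' (m r))"
      proof (intro sum_mono)
        fix G assume "G \<in> \<G>"
        then obtain \<gamma> where "\<gamma> \<in> D \<beta> x" "G \<in> schreier_family A \<gamma>" using \<G>(3) by blast
        then have "p (l0 (m r)) (I r \<inter> G) < \<delta>' (m r)"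
          using blk[of r] \<beta> xm unfolding additive_block_def by blast
        moreover have "p l (I r \<inter> F \<inter> G) \<le> p l (I r \<inter> G)"
          using I_fin l_nonneg by (intro p_mono) auto
        ultimately show "p l (I r \<inter> F \<inter> G) \<le> \<delta>' (m r)"
          using p_eq[of "I r \<inter> G" r] r(1) by simp
      qed
      also have "\<dots> = card \<G> * \<delta>' (m r)" by simp
      also have "\<dots> \<le> (real (m r) + 1) * (1 / (R * (real (m r) + 1)))"
        using \<G>(2) xm \<delta>'_pos[of "m r"] by (intro mult_mono) (auto simp: \<delta>'_def)
      also have "\<dots> = 1 / R"
      proof -
        have "real (m r) + 1 \<noteq> 0" by linarith
        then show ?thesis by simp
      qed
      finally show ?thesis .
    qed
    have "p l (T \<inter> F) \<le> (\<Sum>r<R. p l (T \<inter> F \<inter> I r))"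
      using T(1) l_nonneg by (intro p_Union_le) (auto simp: T_def)
    also have "\<dots> \<le> (\<Sum>r<R. (if r = s then 1 else 0) + 1 / R)"
    proof (intro sum_mono)
      fix r assume "r \<in> {..<R}"
      then have r: "r < R" "T \<inter> F \<inter> I r = I r \<inter> F" by (auto simp: T_def)
      have "p l (I s \<inter> F) \<le> p l (I s)"
        using I_fin l_nonneg by (intro p_mono) auto
      then have "p l (I s \<inter> F) \<le> 1" using p_eq[of "I s" s] s(1) p_I by simp
      then show "p l (T \<inter> F \<inter> I r) \<le> (if r = s then 1 else 0) + 1 / R"
        using r after_s[of r] before_s[of r]
        by (cases r s rule: linorder_cases) (auto intro: add_increasing2)
    qed
    also have "\<dots> = 2" using s(1) R1 by (simp add: sum.distrib)
    finally show ?thesis .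
  qed simp
  have "additive_block A B \<delta> (\<lambda>j. (1 / p l J) * l j) J"
  proof (rule additive_block_normalize)
    show "0 < p l J" using p_J \<delta> by (metis less_trans zero_less_mult_pos zero_less_numeral)
    show "p l (J \<inter> F) < \<delta> * p l J" if "\<beta> \<in> B" "F \<in> schreier_family A \<beta>" for \<beta> F
    proof -
      have "p l (J \<inter> F) \<le> p l (T \<inter> F)"
        using J(1) T(1) l_nonneg by (intro p_mono) auto
      then show ?thesis using small[OF that] p_J by linarith
    qed
  qed (use J T l_pos in \<open>auto intro: finite_subset\<close>)
  then show ?thesis using J(1) T(3) by blast
qed

text \<open>The induction is on a strict upper bound of the whole set \<open>B\<close>. The ordinals
  requested by the step lie below \<open>Max B\<close>, which is itself below \<alpha>.\<close>

lemma additive_block_exists: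
  assumes A: "schreier_system A"
  shows "\<lbrakk>finite B; B \<subseteq> {..<\<alpha>}; 0 < \<delta>; infinite N\<rbrakk> \<Longrightarrow>
    \<exists>l I. additive_block A B \<delta> l I \<and> I \<subseteq> N"
proof (induction \<alpha> arbitrary: B \<delta> N rule: less_induct)
  case (less \<alpha>)
  show ?case
  proof (cases "B = {}")
    case True
    obtain i where "i \<in> N" "i \<ge> 1"
      using less.prems(4) by (meson infinite_nat_iff_unbounded_le)
    then show ?thesis
      using True additive_block_singleton less.prems(3) by (metis empty_subsetI insert_subset less_imp_le)
  next
    case False
    have "\<exists>l I. additive_block A B (min 1 \<delta>) l I \<and> I \<subseteq> N"
    proof (rule additive_block_step[OF A])
      fix B' and \<delta>' :: real and N' :: "nat set"
      assume *: "finite B'" "\<And>\<gamma>. \<gamma> \<in> B' \<Longrightarrow> \<exists>\<beta>\<in>B. \<gamma> < \<beta>" "0 < \<delta>'" "infinite N'"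
      have "Max B < \<alpha>" using False less.prems by auto
      moreover have "B' \<subseteq> {..<Max B}"
        using *(2) less.prems(1) False by (force simp: Max_gr_iff)
      ultimately show "\<exists>l I. additive_block A B' \<delta>' l I \<and> I \<subseteq> N'"
        using less.IH *(1,3,4) by blast
    qed (use less.prems in auto)
    then show ?thesis
      using additive_block_mono by (meson min.cobounded2)
  qed
qed

lemma is_block_exists:
  assumes A: "schreier_system A" and \<epsilon>: "0 < \<epsilon>" "\<epsilon> < 1" and N: "infinite N"
  shows "\<exists>u I. is_block A \<alpha> \<epsilon> f u I \<and> I \<subseteq> N"
proof -
  \<comment> \<open>For \<open>p l J \<ge> \<epsilon>\<close> this gives \<open>(1 + \<epsilon>) *
    \<delta> \<le> 2 * \<delta> = \<epsilon>\<^sup>2 \<le> \<epsilon> * p l J\<close>, turning the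
    additive error into the factor \<open>1 + \<epsilon>\<close>.\<close>
  define \<delta> where "\<delta> = \<epsilon>\<^sup>2 / 2"
  have \<delta>: "0 < \<delta>" "\<delta> < \<epsilon>\<^sup>2" using \<epsilon> by (auto simp: \<delta>_def)
  obtain l I where blk: "additive_block A {\<alpha>} \<delta> l I" and I: "I \<subseteq> N"
    using additive_block_exists[OF A, of "{\<alpha>}" "ord_succ \<alpha>" \<delta> N] less_ord_succ \<delta> N by auto
  obtain t where t: "\<And>J. J \<subseteq> I \<Longrightarrow> p l J \<le> (\<Sum>i\<in>J. l i * f i t) + \<delta>"
    using additive_block_measure[OF blk] by metis
  have "p l J \<le> (1 + \<epsilon>) * (\<Sum>i\<in>J. l i * f i t)" if "J \<subseteq> I" "\<epsilon> \<le> p l J" for J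
  proof -
    have "\<epsilon> * \<epsilon> \<le> \<epsilon> * p l J" using that(2) \<epsilon> by (intro mult_left_mono) auto
    moreover have "\<epsilon> * \<delta> \<le> 1 * \<delta>" using \<epsilon> \<delta> by (intro mult_right_mono) auto
    ultimately have "p l J \<le> (1 + \<epsilon>) * (p l J - \<delta>)"
      by (simp add: algebra_simps \<delta>_def power2_eq_square)
    also have "\<dots> \<le> (1 + \<epsilon>) * (\<Sum>i\<in>J. l i * f i t)"
      using t[OF that(1)] \<epsilon> by (intro mult_left_mono) auto
    finally show ?thesis .
  qed
  moreover have "p l J < \<epsilon>\<^sup>2" if "J \<subseteq> I" "J \<in> schreier_family A \<alpha>" for J
  proof -
    have "p l (I \<inter> J) < \<delta>" using blk that(2) by (simp add: additive_block_def)
    then show ?thesis using that(1) \<delta>(2) by (simp add: Int_absorb1)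
  qed
  ultimately have "is_block A \<alpha> \<epsilon> f (\<Sum>i\<in>I. l i *\<^sub>R f i) I"
    using blk unfolding is_block_def additive_block_def p_def by blast
  then show ?thesis using I by blast
qed

end

section \<open>Transfer of the lower estimates to absolute values\<close>

text \<open>
  The signs of the \<open>e j\<close> at a point where \<open>\<Sum>j\<in>J. l j * \<bar>e j\<bar>\<close> attains its norm turn the lower
  estimates for \<open>e\<close> into lower estimates for \<open>\<bar>e\<bar>\<close>.
\<close>

lemma norm_abs_sum_eq_signed:
  fixes e :: "nat \<Rightarrow> 'a::topological_space \<Rightarrow>\<^sub>C real"
  assumes "compact (UNIV :: 'a set)" and "\<And>j. j \<in> J \<Longrightarrow> 0 \<le> l j"
  shows "\<exists>\<theta>. (\<forall>j. \<bar>\<theta> j\<bar> = 1) \<and>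
    norm (\<Sum>j\<in>J. l j *\<^sub>R abs_bcontfun (e j)) \<le> norm (\<Sum>j\<in>J. (\<theta> j * l j) *\<^sub>R e j)"
proof -
  obtain t where t: "(\<Sum>j\<in>J. l j * \<bar>e j t\<bar>) = norm (\<Sum>j\<in>J. l j *\<^sub>R abs_bcontfun (e j))"
  proof (rule bcontfun_attains_norm[OF assms(1)])
    show "0 \<le> (\<Sum>j\<in>J. l j *\<^sub>R abs_bcontfun (e j)) t" for t
      using assms(2) by (auto simp: apply_bcontfun_sum_scaleR intro!: sum_nonneg)
  qed (simp add: apply_bcontfun_sum_scaleR)
  \<comment> \<open>Unlike \<open>sgn\<close>, this has modulus 1 even where \<open>e j t\<close>
    vanishes, so no coefficient is lost.\<close>
  define \<theta> where "\<theta> j = (if e j t < 0 then - 1 else 1 :: real)" for j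
  have "(\<Sum>j\<in>J. l j * \<bar>e j t\<bar>) = (\<Sum>j\<in>J. (\<theta> j * l j) *\<^sub>R e j) t"
    unfolding apply_bcontfun_sum_scaleR by (intro sum.cong) (auto simp: \<theta>_def)
  also have "\<dots> \<le> norm (\<Sum>j\<in>J. (\<theta> j * l j) *\<^sub>R e j)"
    using norm_bounded[of "\<Sum>j\<in>J. (\<theta> j * l j) *\<^sub>R e j" t] by simp
  finally show ?thesis
    using t by (intro exI[of _ \<theta>]) (auto simp: \<theta>_def)
qed

lemma norm_signed_sum_le_abs:
  fixes e :: "nat \<Rightarrow> 'a::topological_space \<Rightarrow>\<^sub>C real"
  assumes "\<And>j. j \<in> J \<Longrightarrow> \<bar>a j\<bar> \<le> l j"
  shows "norm (\<Sum>j\<in>J. a j *\<^sub>R e j) \<le> norm (\<Sum>j\<in>J. l j *\<^sub>R abs_bcontfun (e j))"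
proof (rule norm_bound)
  fix t
  have "norm ((\<Sum>j\<in>J. a j *\<^sub>R e j) t) \<le> (\<Sum>j\<in>J. \<bar>a j\<bar> * \<bar>e j t\<bar>)"
    by (simp add: apply_bcontfun_sum_scaleR flip: abs_mult)
  also have "\<dots> \<le> (\<Sum>j\<in>J. l j * \<bar>e j t\<bar>)"
    using assms by (intro sum_mono mult_right_mono) auto
  also have "\<dots> = (\<Sum>j\<in>J. l j *\<^sub>R abs_bcontfun (e j)) t"
    by (simp add: apply_bcontfun_sum_scaleR)
  also have "\<dots> \<le> norm (\<Sum>j\<in>J. l j *\<^sub>R abs_bcontfun (e j))"
    using norm_bounded[of "\<Sum>j\<in>J. l j *\<^sub>R abs_bcontfun (e j)" t] by simp
  finally show "norm ((\<Sum>j\<in>J. a j *\<^sub>R e j) t) \<le> norm (\<Sum>j\<in>J. l j *\<^sub>R abs_bcontfun (e j))" .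
qed

lemma norm_abs_bcontfun: "norm (abs_bcontfun g) = norm g"
proof (rule antisym)
  show "norm (abs_bcontfun g) \<le> norm g"
    using norm_bounded[of g] by (intro norm_bound) simp
  show "norm g \<le> norm (abs_bcontfun g)"
    using norm_bounded[of "abs_bcontfun g"] by (intro norm_bound) simp
qed

text \<open>Signs are chosen separately on each block, so that the signed blocks of \<open>e\<close>
  dominate the positive blocks of absolute values. The estimate for \<open>e\<close> applies to
  them, and the norm of their sum is at most that of the positive sum, whatever the signs.\<close>

lemma abs_lower_estimate:
  fixes e :: "nat \<Rightarrow> 'a::topological_space \<Rightarrow>\<^sub>C real"
  assumes K: "compact (UNIV :: 'a set)" and norm_e: "\<And>n. n \<ge> 1 \<Longrightarrow> norm (e n) = 1"
    and C: "\<And>m u F. \<lbrakk>1 \<le> m; block_basis e m u F; m \<le> Min (F 1)\<rbrakk> \<Longrightarrow>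
      C * (\<Sum>i=1..m. norm (u i)) \<le> norm (\<Sum>i=1..m. u i)"
    and "0 < C" and R: "1 \<le> R"
    and I: "\<And>r. r < R \<Longrightarrow> finite (I r) \<and> I r \<noteq> {} \<and> I r \<subseteq> {1..}"
    and before: "\<And>r. Suc r < R \<Longrightarrow> Max (I r) < Min (I (Suc r))" and "R \<le> Min (I 0)"
    and l_nonneg: "\<And>j. 0 \<le> l j" and l_pos: "\<And>r j. r < R \<Longrightarrow> j \<in> I r \<Longrightarrow> 0 < l j"
  shows "C * (\<Sum>r<R. norm (\<Sum>j\<in>I r. l j *\<^sub>R abs_bcontfun (e j)))
    \<le> norm (\<Sum>j\<in>(\<Union>r<R. I r). l j *\<^sub>R abs_bcontfun (e j))"
proof -
  have "\<exists>\<theta>. (\<forall>j. \<bar>\<theta> j\<bar> = 1) \<and> norm (\<Sum>j\<in>I r. l j *\<^sub>R abs_bcontfun (e j))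
      \<le> norm (\<Sum>j\<in>I r. (\<theta> j * l j) *\<^sub>R e j)" for r
    using norm_abs_sum_eq_signed[OF K] l_nonneg by blast
  then have "\<exists>\<theta>. \<forall>r. (\<forall>j. \<bar>\<theta> r j\<bar> = 1) \<and> norm (\<Sum>j\<in>I r. l j *\<^sub>R abs_bcontfun (e j))
      \<le> norm (\<Sum>j\<in>I r. (\<theta> r j * l j) *\<^sub>R e j)"
    by (intro choice allI)
  then obtain \<theta> where \<theta>: "\<And>r j. \<bar>\<theta> r j\<bar> = (1::real)"
    "\<And>r. norm (\<Sum>j\<in>I r. l j *\<^sub>R abs_bcontfun (e j)) \<le> norm (\<Sum>j\<in>I r. (\<theta> r j * l j) *\<^sub>R e j)"
    by blast
  have sep: "i < j" if "r < s" "s < R" "i \<in> I r" "j \<in> I s" for r s i j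
    using that
  proof (induction s arbitrary: j)
    case (Suc s)
    have "Max (I s) < j"
      using before[OF Suc.prems(2)] I[OF Suc.prems(2)] Suc.prems(4)
      by (meson Min_le less_le_trans)
    moreover have "i \<le> Max (I s)"
    proof (cases "r = s")
      case True
      then show ?thesis using I[of s] Suc.prems by simp
    next
      case False
      then have "i < Max (I s)" using Suc I[of s] by (intro Suc.IH) auto
      then show ?thesis by simp
    qed
    ultimately show ?case by simp
  qed simp
  have disj: "I r \<inter> I s = {}" if "r \<noteq> s" "r < R" "s < R" for r s
  proof (rule ccontr)
    assume "I r \<inter> I s \<noteq> {}"
    then obtain x where "x \<in> I r" "x \<in> I s" by auto
    then show False
      using sep[of r s x x] sep[of s r x x] that by (auto simp: neq_iff)
  qed
  \<comment> \<open>The sign comes from the unique block containing \<open>j\<close>. Outside all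
    blocks the index is unspecified, but \<open>\<bar>a j\<bar> = l j\<close> still holds since
    every sign has modulus 1.\<close>
  define a where "a j = \<theta> (THE r. r < R \<and> j \<in> I r) j * l j" for j
  have a_eq: "a j = \<theta> r j * l j" if "r < R" "j \<in> I r" for r j
  proof -
    have "(THE r. r < R \<and> j \<in> I r) = r" using that disj by (intro the_equality) blast+
    then show ?thesis by (simp add: a_def)
  qed
  have abs_a: "\<bar>a j\<bar> = l j" for j
    using \<theta>(1) l_nonneg by (simp add: a_def abs_mult)
  \<comment> \<open>Block bases are numbered from 1 and the sets \<open>I r\<close> from 0, hence
    the shift.\<close>
  define u where "u i = (\<Sum>j\<in>I (i - 1). a j *\<^sub>R e j)" for i
  have u: "norm (\<Sum>j\<in>I r. l j *\<^sub>R abs_bcontfun (e j)) \<le> norm (u (Suc r))" if "r < R" for r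
    using \<theta>(2)[of r] a_eq[OF that] by (simp add: u_def)
  \<comment> \<open>A single term \<open>l i * \<bar>e i\<bar>\<close> has norm
    \<open>l i > 0\<close> and is dominated by the positive block, whose norm is at most that of the
    signed one.\<close>
  have u_ne: "u (Suc r) \<noteq> 0" if r: "r < R" for r
  proof -
    obtain i where i: "i \<in> I r" "i \<ge> 1" using I[OF r] by fastforce
    have "l i = norm (l i *\<^sub>R abs_bcontfun (e i))"
      using norm_e[OF i(2)] l_nonneg[of i] by (simp add: norm_abs_bcontfun)
    also have "\<dots> = norm (\<Sum>j\<in>I r. (if j = i then l i else 0) *\<^sub>R e j)"
      using I[OF r] i by (simp add: if_distrib[of "\<lambda>x. x *\<^sub>R _"] norm_abs_bcontfun cong: if_cong)
    also have "\<dots> \<le> norm (\<Sum>j\<in>I r. l j *\<^sub>R abs_bcontfun (e j))"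
      using l_nonneg by (intro norm_signed_sum_le_abs) auto
    finally show ?thesis using u[OF r] l_pos[OF r i(1)] by auto
  qed
  have "block_basis e R u (\<lambda>i. I (i - 1))"
    unfolding block_basis_def
  proof (intro conjI ballI exI[of _ a])
    fix i assume i: "i \<in> {1..R}"
    then have r: "i - 1 < R" "Suc (i - 1) = i" by auto
    show "finite (I (i - 1))" "I (i - 1) \<noteq> {}" "I (i - 1) \<subseteq> {1..}" using I[OF r(1)] by auto
    show "u i \<noteq> 0" using u_ne[OF r(1)] r(2) by simp
    show "a j \<noteq> 0" if "j \<in> I (i - 1)" for j using abs_a[of j] l_pos[OF r(1) that] by auto
  next
    fix i assume "i \<in> {1..<R}"
    then show "set_before (I (i - 1)) (I (Suc i - 1))"
      using before[of "i - 1"] by (auto simp: set_before_def)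
  qed (simp add: u_def)
  then have est: "C * (\<Sum>i=1..R. norm (u i)) \<le> norm (\<Sum>i=1..R. u i)"
    using C R \<open>R \<le> Min (I 0)\<close> by simp
  have "C * (\<Sum>r<R. norm (\<Sum>j\<in>I r. l j *\<^sub>R abs_bcontfun (e j))) \<le> C * (\<Sum>r<R. norm (u (Suc r)))"
    using u \<open>0 < C\<close> by (intro mult_left_mono sum_mono) auto
  also have "\<dots> \<le> norm (\<Sum>r<R. u (Suc r))" using est by (simp add: sum.atLeast1_atMost_eq)
  also have "(\<Sum>r<R. u (Suc r)) = (\<Sum>j\<in>(\<Union>r<R. I r). a j *\<^sub>R e j)"
    unfolding u_def using I disj by (subst sum.UNION_disjoint) auto
  also have "norm \<dots> \<le> norm (\<Sum>j\<in>(\<Union>r<R. I r). l j *\<^sub>R abs_bcontfun (e j))"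
    using abs_a by (intro norm_signed_sum_le_abs) simp
  finally show ?thesis .
qed

theorem theorem4p3:
  fixes X :: "('a::topological_space \<Rightarrow>\<^sub>C real) set"
    and e :: "nat \<Rightarrow> 'a \<Rightarrow>\<^sub>C real"
    and A :: "countable_ordinal \<Rightarrow> nat \<Rightarrow> countable_ordinal"
    and \<alpha> :: countable_ordinal
    and \<epsilon> :: real
    and N :: "nat set"
  assumes "compact (UNIV :: 'a set)"
    and "metrizable_space (euclidean :: 'a topology)"
    and "schreier_system A"
    and "banach_subspace X"
    and "normalized_schauder_basis e X"
    and "asymptotic_l1 e"
    and "0 < \<epsilon>" and "\<epsilon> < 1"
    and "N \<subseteq> {1..}" and "infinite N"
  shows "\<exists>u I. is_block A \<alpha> \<epsilon> (\<lambda>n. abs_bcontfun (e n)) u I \<and> I \<subseteq> N"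
proof -
  have norm_e: "norm (e n) = 1" if "n \<ge> 1" for n
    using assms(5) that by (simp add: normalized_schauder_basis_def)
  obtain C where C: "0 < C" "\<And>m u F. \<lbrakk>1 \<le> m; block_basis e m u F; m \<le> Min (F 1)\<rbrakk> \<Longrightarrow>
      C * (\<Sum>i=1..m. norm (u i)) \<le> norm (\<Sum>i=1..m. u i)"
    using assms(6) unfolding asymptotic_l1_def by blast
  interpret asymptotic_l1_positive "\<lambda>n. abs_bcontfun (e n)" C
  proof
    show "norm (abs_bcontfun (e n)) = 1" if "n \<ge> 1" for n
      using norm_e[OF that] by (simp add: norm_abs_bcontfun)
    show "C * (\<Sum>r<R. norm (\<Sum>j\<in>I r. l j *\<^sub>R abs_bcontfun (e j)))
        \<le> norm (\<Sum>j\<in>(\<Union>r<R. I r). l j *\<^sub>R abs_bcontfun (e j))"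
      if "1 \<le> R" "\<And>r. r < R \<Longrightarrow> finite (I r) \<and> I r \<noteq> {} \<and> I r \<subseteq> {1..}"
        "\<And>r. Suc r < R \<Longrightarrow> Max (I r) < Min (I (Suc r))" "R \<le> Min (I 0)"
        "\<And>j. 0 \<le> l j" "\<And>r j. r < R \<Longrightarrow> j \<in> I r \<Longrightarrow> 0 < l j" for R I l
      by (rule abs_lower_estimate[OF assms(1) norm_e C(2,1) that])
  qed (simp_all add: assms(1) C(1))
  show ?thesis
    by (rule is_block_exists[OF assms(3,7,8,10)])
qed

end
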